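(* Let $\Sigma$ be a set and $\alpha:X\to\mathcal{P}(\Sigma_\varepsilon\times X+1)$ an $\varepsilon$-NA. Let $\underline{\alpha}:X\to\mathcal{P}(\Sigma^{*}\times X+\Sigma^{*})$ be its translation, and define $\mathrm{tr}_{\underline{\alpha}}:X\to\mathcal{P}(\Sigma^{*})$ by $\mathrm{tr}_{\underline{\alpha}}=\bigvee_{n\in\mathbb{N}}\perp\cdot\underline{\alpha}^{n}$, where $\cdot$ and powers are taken in $\mathcal{K}l(\mathcal{P}(\Sigma^{*}\times\mathcal{I}d+\Sigma^{*}))$. Then $\mathrm{tr}_{\underline{\alpha}}$ coincides with the trace semantics morphism $\mathrm{tr}_\alpha$ of the $\varepsilon$-NA $\alpha$.
   Context: $\Sigma_\varepsilon=\Sigma+\{\varepsilon\}$, $1=\{\checkmark\}$, and $\Sigma^*$ is the set of finite words over $\Sigma$ with empty word $\varepsilon$. An $\varepsilon$-NA is a map $\alpha:X\to\mathcal{P}(\Sigma_\varepsilon\times X+1)$; write $x\xrightarrow{\sigma}x'$ for $(\sigma,x')\in\alpha(x)$; $x$ is final if $\checkmark\in\alpha(x)$. Its trace semantics $\mathrm{tr}_\alpha:X\to\mathcal{P}(\Sigma^* )$: $w\in\mathrm{tr}_\alpha(x)$ iff either $w=\varepsilon$ and $\checkmark\in\alpha(x)$, or $w=a_1\cdots a_n$ with $a_i\in\Sigma$ and there is $x'$ with $\checkmark\in\alpha(x')$ and $x\,(\xrightarrow{\varepsilon})^*\circ\xrightarrow{a_1}\circ(\xrightarrow{\varepsilon})^*\cdots(\xrightarrow{\varepsilon})^*\circ\xrightarrow{a_n}\circ(\xrightarrow{\varepsilon})^*\,x'$,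 where $R^*$ is reflexive–transitive closure. The translation is $\underline{\alpha}(x)=\{(a,y)\in\Sigma^*\times X\mid (a,y)\in\alpha(x)\}\cup A_x$, where letters $a\in\Sigma$ and $\varepsilon$ are regarded as words of length $\le1$ (so $(\varepsilon,y)\in\alpha(x)$ gives $(\varepsilon,y)\in\underline\alpha(x)$), and $A_x=\{\varepsilon\}$ if $\checkmark\in\alpha(x)$, else $\varnothing$. The monad $\mathcal{P}(\Sigma^*\times\mathcal{I}d+\Sigma^* )$ has Kleisli composition: for $f:X\to\mathcal{P}(\Sigma^*\times Y+\Sigma^* )$, $g:Y\to\mathcal{P}(\Sigma^*\times Z+\Sigma^* )$, $(g\cdot f)(x)=\{(s_1s_2,z)\mid (s_1,y)\in f(x),(s_2,z)\in g(y)\}\cup\{s_1s_2\mid (s_1,y)\in f(x), s_2\in g(y)\}\cup\{s_1\mid s_1\in f(x)\cap\Sigma^*\}$; the identity is $x\mapsto\{(\varepsilon,x)\}$, so $\underline\alpha^0$ is the identity. Morphisms $X\multimap\varnothing$ are maps $X\to\mathcal{P}(\Sigma^* )$; $\perp:X\to\mathcal{P}(\Sigma^* )$ is $x\mapsto\varnothing$, and $\bigvee$ is pointwise union. *)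

theory Defs
  imports Main
begin

text \<open>In \<open>\<Sigma>\<^sub>\<epsilon> = 'a option\<close>, \<^term>\<open>None\<close> is the silent label \<open>\<epsilon>\<close>; the only element of
  \<open>1 = unit\<close> is the termination mark.\<close>

type_synonym ('a, 'x) eps_na = "'x \<Rightarrow> ('a option \<times> 'x + unit) set"

definition eps_step :: "('a, 'x) eps_na \<Rightarrow> 'a option \<Rightarrow> 'x rel" where
  "eps_step \<alpha> \<sigma> = {(x, x'). Inl (\<sigma>, x') \<in> \<alpha> x}"

definition final :: "('a, 'x) eps_na \<Rightarrow> 'x \<Rightarrow> bool" where
  "final \<alpha> x \<longleftrightarrow> Inr () \<in> \<alpha> x"

text \<open>The relation composition \<^term>\<open>(O)\<close> is in diagrammatic order.\<close>

primrec word_path :: "('a, 'x) eps_na \<Rightarrow> 'a list \<Rightarrow> 'x rel" where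
  "word_path \<alpha> [] = (eps_step \<alpha> None)\<^sup>*"
| "word_path \<alpha> (a # w) = (eps_step \<alpha> None)\<^sup>* O eps_step \<alpha> (Some a) O word_path \<alpha> w"

text \<open>The second alternative includes words of length 0, for which the path consists of
  \<open>\<epsilon>\<close>-steps only.\<close>

definition tr_na :: "('a, 'x) eps_na \<Rightarrow> 'x \<Rightarrow> 'a list set" where
  "tr_na \<alpha> x =
     {w. (w = [] \<and> final \<alpha> x) \<or> (\<exists>x'. final \<alpha> x' \<and> (x, x') \<in> word_path \<alpha> w)}"

type_synonym ('a, 'x, 'y) kl = "'x \<Rightarrow> ('a list \<times> 'y + 'a list) set"

definition kl_id :: "('a, 'x, 'x) kl" where
  "kl_id x = {Inl ([], x)}"

definition kl_comp :: "('a, 'y, 'z) kl \<Rightarrow> ('a, 'x, 'y) kl \<Rightarrow> ('a, 'x, 'z) kl" where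
  "kl_comp g f x =
     {Inl (s1 @ s2, z) | s1 s2 y z. Inl (s1, y) \<in> f x \<and> Inl (s2, z) \<in> g y} \<union>
     {Inr (s1 @ s2) | s1 s2 y. Inl (s1, y) \<in> f x \<and> Inr s2 \<in> g y} \<union>
     {Inr s1 | s1. Inr s1 \<in> f x}"

primrec kl_power :: "('a, 'x, 'x) kl \<Rightarrow> nat \<Rightarrow> ('a, 'x, 'x) kl" where
  "kl_power f 0 = kl_id"
| "kl_power f (Suc n) = kl_comp f (kl_power f n)"

text \<open>HOL has no empty type, so a morphism \<open>g\<close> from \<open>Y\<close> to the empty object is given as a map
  into \<open>\<P>(\<Sigma>\<^sup>*)\<close>. It is composed by viewing it as a morphism to \<^typ>\<open>unit\<close> that only takes values
  in the right summand \<open>\<Sigma>\<^sup>*\<close>. By \<open>Inr_image_kl_comp_empty\<close>, the composite is again of this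
  form, and any other type in place of \<^typ>\<open>unit\<close> gives the same result.\<close>

definition kl_comp_empty :: "('y \<Rightarrow> 'a list set) \<Rightarrow> ('a, 'x, 'y) kl \<Rightarrow> 'x \<Rightarrow> 'a list set" where
  "kl_comp_empty g f x = {w. Inr w \<in> kl_comp (\<lambda>y. Inr ` g y :: ('a list \<times> unit + 'a list) set) f x}"

lemma Inl_in_kl_comp:
  "Inl (w, z) \<in> kl_comp g f x \<longleftrightarrow>
     (\<exists>s1 s2 y. w = s1 @ s2 \<and> Inl (s1, y) \<in> f x \<and> Inl (s2, z) \<in> g y)"
  unfolding kl_comp_def by blast

lemma Inr_in_kl_comp:
  "Inr w \<in> kl_comp g f x \<longleftrightarrow>
     (\<exists>s1 s2 y. w = s1 @ s2 \<and> Inl (s1, y) \<in> f x \<and> Inr s2 \<in> g y) \<or> Inr w \<in> f x"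
  unfolding kl_comp_def by blast

lemma kl_eqI:
  assumes "\<And>x w z. Inl (w, z) \<in> f x \<longleftrightarrow> Inl (w, z) \<in> g x"
    and "\<And>x w. Inr w \<in> f x \<longleftrightarrow> Inr w \<in> g x"
  shows "f = (g :: ('a, 'x, 'y) kl)"
proof (intro ext set_eqI)
  fix x u show "u \<in> f x \<longleftrightarrow> u \<in> g x"
    using assms by (cases u) auto
qed

lemma kl_comp_empty_eq:
  "kl_comp_empty g f x =
     {s1 @ s2 | s1 s2 y. Inl (s1, y) \<in> f x \<and> s2 \<in> g y} \<union> {s1. Inr s1 \<in> f x}"
  unfolding kl_comp_empty_def Inr_in_kl_comp by (auto simp: image_iff)

lemma Inr_image_kl_comp_empty:
  "(\<lambda>x. Inr ` kl_comp_empty g f x) = kl_comp (\<lambda>y. Inr ` g y) f"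
  by (rule kl_eqI) (auto simp: Inl_in_kl_comp Inr_in_kl_comp kl_comp_empty_eq image_iff)

lemma kl_comp_id_left: "kl_comp kl_id f = f"
  by (rule kl_eqI) (auto simp: Inl_in_kl_comp Inr_in_kl_comp kl_id_def)

lemma kl_comp_id_right: "kl_comp f kl_id = f"
  by (rule kl_eqI) (auto simp: Inl_in_kl_comp Inr_in_kl_comp kl_id_def)

lemma kl_comp_assoc: "kl_comp h (kl_comp g f) = kl_comp (kl_comp h g) f"
proof (rule kl_eqI)
  fix x w z
  show "Inl (w, z) \<in> kl_comp h (kl_comp g f) x \<longleftrightarrow> Inl (w, z) \<in> kl_comp (kl_comp h g) f x"
    unfolding Inl_in_kl_comp by (metis append.assoc)
next
  fix x w
  show "Inr w \<in> kl_comp h (kl_comp g f) x \<longleftrightarrow> Inr w \<in> kl_comp (kl_comp h g) f x"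
    unfolding Inl_in_kl_comp Inr_in_kl_comp
    by (rule iffI; elim disjE exE conjE) (metis append.assoc)+
qed

text \<open>The supremum in the function lattice is the pointwise union, and \<^term>\<open>bot\<close> is constantly
  empty.\<close>

definition tr_kl :: "('a, 'x, 'x) kl \<Rightarrow> 'x \<Rightarrow> 'a list set" where
  "tr_kl f = (SUP n. kl_comp_empty bot (kl_power f n))"

primrec label_word :: "'a option \<Rightarrow> 'a list" where
  "label_word None = []"
| "label_word (Some a) = [a]"

definition translation :: "('a, 'x) eps_na \<Rightarrow> ('a, 'x, 'x) kl" where
  "translation \<alpha> x =
     {Inl (label_word \<sigma>, y) | \<sigma> y. Inl (\<sigma>, y) \<in> \<alpha> x} \<union> (if final \<alpha> x then {Inr []} else {})"

end

theory Submission
  imports Defs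
begin

text \<open>Non-terminating outputs \<open>(w, y)\<close> of the Kleisli powers of the translation are exactly the
  \<open>w\<close>-labelled paths to \<open>y\<close>, because both kinds of path are closed under concatenation. The
  translation terminates only with the empty word and only in final states, so a word is output
  on termination by some power iff it labels a path to a final state.\<close>

lemma kl_power_add: "kl_power f (m + n) = kl_comp (kl_power f m) (kl_power f n)"
  by (induction m) (simp_all add: kl_comp_id_left kl_comp_assoc)

lemma Inl_in_kl_power_append:
  assumes "Inl (u, y) \<in> kl_power f n x" and "Inl (v, z) \<in> kl_power f m y"
  shows "Inl (u @ v, z) \<in> kl_power f (m + n) x"
  using assms by (auto simp: kl_power_add Inl_in_kl_comp)

text \<open>Composing with \<open>bot\<close> discards every pair and keeps exactly the words on
  which a power has already terminated.\<close>

lemma in_tr_kl_iff: "w \<in> tr_kl f x \<longleftrightarrow> (\<exists>n. Inr w \<in> kl_power f n x)"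
  by (simp add: tr_kl_def kl_comp_empty_eq)

lemma Inl_in_translation_iff:
  "Inl (w, y) \<in> translation \<alpha> x \<longleftrightarrow> (\<exists>\<sigma>. w = label_word \<sigma> \<and> (x, y) \<in> eps_step \<alpha> \<sigma>)"
  by (auto simp: translation_def eps_step_def)

lemma Inr_in_translation_iff: "Inr w \<in> translation \<alpha> x \<longleftrightarrow> w = [] \<and> final \<alpha> x"
  by (auto simp: translation_def)

text \<open>Every path begins with an \<epsilon>-closure, which absorbs further silent steps by
  transitivity.\<close>

lemma word_path_prepend_eps:
  assumes "(x, y) \<in> (eps_step \<alpha> None)\<^sup>*" and "(y, z) \<in> word_path \<alpha> w"
  shows "(x, z) \<in> word_path \<alpha> w"
  using assms by (cases w) (auto intro: rtrancl_trans)

text \<open>At the junction, the trailing \<epsilon>-closure of the first path merges into the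
  leading one of the second.\<close>

lemma word_path_append:
  assumes "(x, y) \<in> word_path \<alpha> u" and "(y, z) \<in> word_path \<alpha> v"
  shows "(x, z) \<in> word_path \<alpha> (u @ v)"
  using assms by (induction u arbitrary: x) (auto intro: word_path_prepend_eps)

lemma eps_step_imp_word_path:
  assumes "(x, y) \<in> eps_step \<alpha> \<sigma>"
  shows "(x, y) \<in> word_path \<alpha> (label_word \<sigma>)"
  using assms by (cases \<sigma>) auto

lemma kl_power_imp_word_path:
  "Inl (w, y) \<in> kl_power (translation \<alpha>) n x \<Longrightarrow> (x, y) \<in> word_path \<alpha> w"
proof (induction n arbitrary: w y)
  case 0
  then show ?case by (simp add: kl_id_def)
next
  case (Suc n)
  \<comment> \<open>A power grows by a last step while \<open>word_path\<close> recurses on the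
    first letter; \<open>word_path_append\<close> bridges the two.\<close>
  then show ?case
    by (auto simp: Inl_in_kl_comp Inl_in_translation_iff
        intro: word_path_append eps_step_imp_word_path)
qed

lemma eps_step_imp_kl_power:
  assumes "(x, y) \<in> eps_step \<alpha> \<sigma>"
  shows "Inl (label_word \<sigma>, y) \<in> kl_power (translation \<alpha>) 1 x"
  using assms by (auto simp: kl_comp_id_right Inl_in_translation_iff)

text \<open>The exponent counts silent steps, whereas the word stays empty because
  \<open>label_word None\<close> is \<open>[]\<close>.\<close>

lemma eps_steps_imp_kl_power:
  assumes "(x, y) \<in> (eps_step \<alpha> None)\<^sup>*"
  shows "\<exists>n. Inl ([], y) \<in> kl_power (translation \<alpha>) n x"
  using assms
proof (induction rule: rtrancl_induct)
  case base
  have "Inl ([], x) \<in> kl_power (translation \<alpha>) 0 x" by (simp add: kl_id_def)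
  then show ?case by blast
next
  case (step y z)
  then obtain n where "Inl ([], y) \<in> kl_power (translation \<alpha>) n x" by blast
  from Inl_in_kl_power_append[OF this eps_step_imp_kl_power[OF step.hyps(2)]]
  show ?case unfolding label_word.simps append_Nil by blast
qed

lemma word_path_imp_kl_power:
  "(x, y) \<in> word_path \<alpha> w \<Longrightarrow> \<exists>n. Inl (w, y) \<in> kl_power (translation \<alpha>) n x"
proof (induction w arbitrary: x)
  case Nil
  then show ?case by (simp add: eps_steps_imp_kl_power)
next
  case (Cons a w)
  then obtain u v where "(x, u) \<in> (eps_step \<alpha> None)\<^sup>*" and uv: "(u, v) \<in> eps_step \<alpha> (Some a)"
    and "(v, y) \<in> word_path \<alpha> w"
    by auto
  then obtain n m where "Inl ([], u) \<in> kl_power (translation \<alpha>) n x"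
    and "Inl (w, y) \<in> kl_power (translation \<alpha>) m v"
    using eps_steps_imp_kl_power Cons.IH by metis
  \<comment> \<open>The path is cut into \<open>n\<close> silent steps, one \<open>a\<close>-step
    and \<open>m\<close> further steps. Exponents add up from right to left, since the right
    argument of \<open>kl_comp\<close> acts first.\<close>
  then have "Inl (([] @ label_word (Some a)) @ w, y) \<in> kl_power (translation \<alpha>) (m + (1 + n)) x"
    using eps_step_imp_kl_power[OF uv] by (intro Inl_in_kl_power_append)
  then show ?case unfolding label_word.simps append_Nil append_Cons by blast
qed

lemma ex_Inl_in_kl_power_iff:
  "(\<exists>n. Inl (w, y) \<in> kl_power (translation \<alpha>) n x) \<longleftrightarrow> (x, y) \<in> word_path \<alpha> w"
  using kl_power_imp_word_path word_path_imp_kl_power by metis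

text \<open>The last step either terminates now, contributing the empty word, or passes on a word
  that had terminated earlier.\<close>

lemma Inr_in_kl_power_Suc_iff:
  "Inr w \<in> kl_power (translation \<alpha>) (Suc n) x \<longleftrightarrow>
     (\<exists>y. Inl (w, y) \<in> kl_power (translation \<alpha>) n x \<and> final \<alpha> y) \<or>
     Inr w \<in> kl_power (translation \<alpha>) n x"
  by (auto simp: Inr_in_kl_comp Inr_in_translation_iff)

text \<open>A terminated word can be traced back to the power at which it first terminated, as power
  0 contains only a pair. Conversely, one more power turns a pair with a final state into a
  terminated word.\<close>

lemma ex_Inr_in_kl_power_iff:
  "(\<exists>n. Inr w \<in> kl_power (translation \<alpha>) n x) \<longleftrightarrow>
     (\<exists>y n. Inl (w, y) \<in> kl_power (translation \<alpha>) n x \<and> final \<alpha> y)"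
proof
  assume "\<exists>n. Inr w \<in> kl_power (translation \<alpha>) n x"
  then obtain n where "Inr w \<in> kl_power (translation \<alpha>) n x" ..
  then show "\<exists>y n. Inl (w, y) \<in> kl_power (translation \<alpha>) n x \<and> final \<alpha> y"
  proof (induction n)
    case 0
    then show ?case by (simp add: kl_id_def)
  next
    case (Suc n)
    then show ?case unfolding Inr_in_kl_power_Suc_iff by blast
  qed
next
  assume "\<exists>y n. Inl (w, y) \<in> kl_power (translation \<alpha>) n x \<and> final \<alpha> y"
  then show "\<exists>n. Inr w \<in> kl_power (translation \<alpha>) n x"
    using Inr_in_kl_power_Suc_iff by metis
qed

theorem theorem9:
  fixes \<alpha> :: "('a, 'x) eps_na"
  shows "tr_kl (translation \<alpha>) = tr_na \<alpha>"
proof (intro ext set_eqI)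
  fix x w
  have "w \<in> tr_kl (translation \<alpha>) x \<longleftrightarrow> (\<exists>y. (x, y) \<in> word_path \<alpha> w \<and> final \<alpha> y)"
    unfolding in_tr_kl_iff ex_Inr_in_kl_power_iff ex_Inl_in_kl_power_iff[symmetric] by blast
  \<comment> \<open>In the first alternative of \<open>tr_na\<close>, the witness is
    \<open>x\<close> itself, by reflexivity of \<open>word_path \<alpha> []\<close>.\<close>
  also have "\<dots> \<longleftrightarrow> w \<in> tr_na \<alpha> x"
    by (auto simp: tr_na_def)
  finally show "w \<in> tr_kl (translation \<alpha>) x \<longleftrightarrow> w \<in> tr_na \<alpha> x" .
qed

end
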